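(* Let $X,Y$ be real Hilbert spaces, $A\in L(X,Y)$, and let $R\colon X\to[0,\infty]$ be convex, coercive and weakly lower semicontinuous with $R\not\equiv\infty$. Let $y^\dagger\in Y$ and let $x^\dagger\in X$ be an $R$-minimizing solution of $Ax=y^\dagger$ which fulfills the source condition $$\exists\, w\in Y:\quad A^*w\in\partial R(x^\dagger).$$ For $\delta>0$ let $y^\delta\in Y$ satisfy $\|y^\delta-y^\dagger\|\le\delta$. Let $\beta>0$ be fixed and assume that there exist ADP-$\beta$ solutions $\hat x_\alpha^\delta$, i.e. solutions of $$\min_{B\in L(X,Y)}\ \frac12\|Ax(B)-y^\delta\|^2+\beta\|B-A\|^2\quad\text{s.t.}\quad x(B)=\arg\min_{x\in X}\frac12\|Bx-y^\delta\|^2+\alpha R(x).$$ If $\alpha$ is chosen proportional to $\delta$ (i.e. $\alpha=c\,\delta$ with a constant $c>0$), then there exists $d\in D_R(\hat x_\alpha^\delta,x^\dagger)$ which fulfills $d=O(\delta)$ as $\delta\to0$.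
   Context: $L(X,Y)$ is the space of bounded linear operators with the operator norm. $\partial R(x)=\{p\in X: R(z)\ge R(x)+\langle p,z-x\rangle\ \forall z\in X\}$ if $R(x)<\infty$, and $\partial R(x)=\emptyset$ otherwise. The Bregman distance is the set $D_R(\tilde x,x)=\{R(\tilde x)-R(x)-\langle p,\tilde x-x\rangle : p\in\partial R(x)\}$. An $R$-minimizing solution of $Ax=y^\dagger$ is an $x^\dagger$ with $Ax^\dagger=y^\dagger$ and $R(x^\dagger)=\min\{R(x):Ax=y^\dagger\}$. An ADP-$\beta$ solution is $\hat x_\alpha^\delta=x(\hat B)$ where $\hat B$ attains the outer minimum; if the inner minimizer is not unique, the problem is understood as minimizing $\frac12\|Ax-y^\delta\|^2+\beta\|B-A\|^2$ over all pairs $(B,x)$ with $x$ a minimizer of $z\mapsto\frac12\|Bz-y^\delta\|^2+\alpha R(z)$, and $\hat x_\alpha^\delta$ is the $x$-component of a minimizing pair. *)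

theory Defs
  imports "HOL-Analysis.Analysis" "HOL-Library.Landau_Symbols"
begin

definition convex_fun :: "('a::real_vector \<Rightarrow> ereal) \<Rightarrow> bool" where
  "convex_fun R \<longleftrightarrow>
     (\<forall>x y. \<forall>t\<in>{0..1::real}.
        R ((1 - t) *\<^sub>R x + t *\<^sub>R y) \<le> ereal (1 - t) * R x + ereal t * R y)"

definition coercive :: "('a::real_normed_vector \<Rightarrow> ereal) \<Rightarrow> bool" where
  "coercive R \<longleftrightarrow> (R \<longlongrightarrow> \<infinity>) at_infinity"

definition weakly_tendsto :: "(nat \<Rightarrow> 'a::real_normed_vector) \<Rightarrow> 'a \<Rightarrow> bool" where
  "weakly_tendsto X x \<longleftrightarrow> (\<forall>f :: 'a \<Rightarrow>\<^sub>L real. (\<lambda>n. f (X n)) \<longlonglongrightarrow> f x)"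

(* Sequential form; it is implied by lower semicontinuity with respect to the weak topology. *)
definition weakly_lsc :: "('a::real_normed_vector \<Rightarrow> ereal) \<Rightarrow> bool" where
  "weakly_lsc R \<longleftrightarrow> (\<forall>X x. weakly_tendsto X x \<longrightarrow> R x \<le> liminf (\<lambda>n. R (X n)))"

definition subdifferential :: "('a::real_inner \<Rightarrow> ereal) \<Rightarrow> 'a \<Rightarrow> 'a set" where
  "subdifferential R x =
     (if R x < \<infinity> then {p. \<forall>z. R z \<ge> R x + ereal (p \<bullet> (z - x))} else {})"

(* The subtraction of R x is never of the form infinity - infinity: the set is empty unless
   R x < infinity. *)
definition bregman :: "('a::real_inner \<Rightarrow> ereal) \<Rightarrow> 'a \<Rightarrow> 'a \<Rightarrow> ereal set" where
  "bregman R x' x = {R x' - R x - ereal (p \<bullet> (x' - x)) | p. p \<in> subdifferential R x}"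

definition R_minimizing_solution ::
  "('a::real_normed_vector \<Rightarrow> ereal) \<Rightarrow> ('a \<Rightarrow>\<^sub>L 'b::real_normed_vector) \<Rightarrow> 'b \<Rightarrow> 'a \<Rightarrow> bool" where
  "R_minimizing_solution R A y x \<longleftrightarrow> is_arg_min R (\<lambda>z. A z = y) x"

definition tikhonov ::
  "('a::real_normed_vector \<Rightarrow> ereal) \<Rightarrow> real \<Rightarrow> 'b::real_normed_vector \<Rightarrow> ('a \<Rightarrow>\<^sub>L 'b) \<Rightarrow> 'a \<Rightarrow> ereal" where
  "tikhonov R \<alpha> y B x = ereal (1/2 * (norm (B x - y))\<^sup>2) + ereal \<alpha> * R x"

definition tikhonov_minimizer ::
  "('a::real_normed_vector \<Rightarrow> ereal) \<Rightarrow> real \<Rightarrow> 'b::real_normed_vector \<Rightarrow> ('a \<Rightarrow>\<^sub>L 'b) \<Rightarrow> 'a \<Rightarrow> bool" where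
  "tikhonov_minimizer R \<alpha> y B x \<longleftrightarrow> is_arg_min (tikhonov R \<alpha> y B) (\<lambda>_. True) x"

(* The minimization runs over all pairs (B, x) with x an inner minimizer for B; when inner
   minimizers are unique, this is the minimization over B with x = x(B). *)
definition ADP_solution ::
  "('a::real_normed_vector \<Rightarrow> ereal) \<Rightarrow> ('a \<Rightarrow>\<^sub>L 'b::real_normed_vector) \<Rightarrow> real \<Rightarrow> real \<Rightarrow> 'b \<Rightarrow> 'a \<Rightarrow> bool" where
  "ADP_solution R A \<beta> \<alpha> y x \<longleftrightarrow>
     (\<exists>B. is_arg_min (\<lambda>(B, x). 1/2 * (norm (A x - y))\<^sup>2 + \<beta> * (norm (B - A))\<^sup>2)
                     (\<lambda>(B, x). tikhonov_minimizer R \<alpha> y B x) (B, x))"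

end

theory Submission
  imports Defs
begin

text \<open>
  Write \<open>x\<close> for the \<open>R\<close>-minimizing solution, \<open>p\<close> for the subgradient \<open>A\<^sup>* w\<close>, \<open>v\<close> for the ADP solution
  and \<open>B\<close> for the operator it comes from. The outer problem compares \<open>(B, v)\<close> with the pair
  \<open>(A, z)\<close>, where \<open>z\<close> minimizes the Tikhonov functional of \<open>A\<close> itself. Classical Tikhonov theory
  under the source condition bounds the residual of \<open>z\<close> by a multiple of \<open>\<delta>\<close>
  (\<open>tikhonov_residual_le\<close>), and so the outer objective at \<open>(B, v)\<close> is of order \<open>\<delta>\<^sup>2\<close>. As \<open>\<beta>\<close> is
  fixed, both the residual of \<open>v\<close> under \<open>A\<close> and the operator error \<open>B - A\<close> are of order \<open>\<delta>\<close>.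

  Now compare \<open>v\<close> with \<open>x\<close> in the inner problem. The residual of \<open>x\<close> under \<open>B\<close> is of order \<open>\<delta>\<close>,
  because \<open>A x = y\<close>; dividing the inner inequality by \<open>\<alpha> = c \<delta>\<close> gives that \<open>R v - R x\<close> is at most
  a multiple of \<open>\<delta>\<close>. The linear term of the Bregman distance, \<open>- p \<bullet> (v - x) = - w \<bullet> A (v - x)\<close>,
  is controlled by the residual of \<open>v\<close>. The Bregman distance taken with \<open>p\<close> is nonnegative, so it
  is of order \<open>\<delta>\<close>.

  Two facts of Hilbert space theory enter: the comparison element \<open>z\<close> exists, and \<open>adjoint\<close>
  really is the Hilbert adjoint of a bounded operator. Both follow from one minimization
  principle, \<open>attains_min_Hilbert\<close>: a functional with closed, convex and bounded sublevel sets
  attains its minimum. It is proved without weak compactness: almost norm-minimal elements of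
  nested closed convex sets form a Cauchy sequence by the parallelogram law.
\<close>

section \<open>Minimization in Hilbert space\<close>

text \<open>
  The squared minimal norms of the sets increase to a limit. For almost minimal elements \<open>u n\<close> the
  midpoint of \<open>u n\<close> and \<open>u m\<close>, \<open>n \<le> m\<close>, still lies in \<open>C n\<close>, and the parallelogram law makes
  them close to each other.
\<close>
lemma decseq_convex_closed_Inter_nonempty:
  fixes C :: "nat \<Rightarrow> 'a::{real_inner,complete_space} set"
  assumes closed: "\<And>n. closed (C n)" and convex: "\<And>n. convex (C n)"
    and nonempty: "\<And>n. C n \<noteq> {}" and dec: "decseq C" and bounded: "bounded (C 0)"
  shows "(\<Inter>n. C n) \<noteq> {}"
proof -
  define s where "s n = (INF u\<in>C n. (norm u)\<^sup>2)" for n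
  have sub: "C m \<subseteq> C n" if "n \<le> m" for n m
    using dec that by (auto simp: decseq_def)
  \<comment> \<open>The set \<open>S\<close> is arbitrary, as infima over different \<open>C n\<close> are compared below.\<close>
  have bdd: "bdd_below ((\<lambda>u. (norm u)\<^sup>2) ` S)" for S :: "'a set"
    by (auto simp: bdd_below_def intro!: exI[of _ 0])
  have s_le: "s n \<le> (norm u)\<^sup>2" if "u \<in> C n" for n u
    unfolding s_def using that by (intro cINF_lower bdd) auto
  have ex: "\<exists>u. u \<in> C n \<and> (norm u)\<^sup>2 < s n + 1 / Suc n" for n
  proof -
    have "s n < s n + 1 / Suc n" by simp
    then show ?thesis
      unfolding s_def using cINF_less_iff[OF nonempty[of n] bdd] by blast
  qed
  obtain u where u: "\<And>n. u n \<in> C n" and u_less: "\<And>n. (norm (u n))\<^sup>2 < s n + 1 / Suc n"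
    using ex by metis
  have "incseq s"
  proof (rule monoI)
    fix m n :: nat assume "m \<le> n"
    then show "s m \<le> s n"
      unfolding s_def by (intro cINF_superset_mono nonempty bdd sub) auto
  qed
  obtain K where K: "\<And>v. v \<in> C 0 \<Longrightarrow> norm v \<le> K"
    using bounded by (auto simp: bounded_iff)
  have "s n \<le> K\<^sup>2" for n
  proof -
    have "(norm (u n))\<^sup>2 \<le> K\<^sup>2"
      using K[of "u n"] u[of n] sub[of 0 n] by (intro power_mono) auto
    with s_le[OF u[of n]] show ?thesis by linarith
  qed
  then obtain L where L: "s \<longlonglongrightarrow> L" and s_L: "\<And>n. s n \<le> L"
    using incseq_convergent[OF \<open>incseq s\<close>, of "K\<^sup>2"] by auto
  define e where "e n = 2 * (L - s n) + 4 / Suc n" for n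
  have "(\<lambda>n. 2 * (L - s n) + 4 * (1 / Suc n)) \<longlonglongrightarrow> 2 * (L - L) + 4 * 0"
    by (intro tendsto_intros L LIMSEQ_Suc[OF lim_1_over_n])
  then have e: "e \<longlonglongrightarrow> 0" unfolding e_def by simp
  have dist_le: "(dist (u n) (u m))\<^sup>2 \<le> e n" if "n \<le> m" for n m
  proof -
    have "(1/2) *\<^sub>R u n + (1/2) *\<^sub>R u m \<in> C n"
      using convex[of n] u[of n] u[of m] sub[OF that] by (intro convexD) auto
    from s_le[OF this] have mid: "4 * s n \<le> (norm (u n + u m))\<^sup>2"
      unfolding power2_norm_eq_inner by (simp add: inner_simps inner_commute)
    have par: "(dist (u n) (u m))\<^sup>2 = 2 * (norm (u n))\<^sup>2 + 2 * (norm (u m))\<^sup>2 - (norm (u n + u m))\<^sup>2"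
      unfolding dist_norm power2_norm_eq_inner by (simp add: inner_simps inner_commute)
    have "1 / real (Suc m) \<le> 1 / Suc n"
      using that by (simp add: frac_le)
    then show ?thesis
      unfolding par e_def using mid u_less[of n] u_less[of m] s_L[of m] by simp
  qed
  have "Cauchy u"
  proof (rule CauchyI')
    fix \<epsilon> :: real assume "\<epsilon> > 0"
    then have "eventually (\<lambda>n. e n < \<epsilon>\<^sup>2) sequentially"
      using order_tendstoD(2)[OF e, of "\<epsilon>\<^sup>2"] by simp
    then obtain M where M: "\<And>n. n \<ge> M \<Longrightarrow> e n < \<epsilon>\<^sup>2"
      by (auto simp: eventually_sequentially)
    have "dist (u m) (u n) < \<epsilon>" if "m \<ge> M" "n > m" for m n
    proof -
      have "(dist (u m) (u n))\<^sup>2 < \<epsilon>\<^sup>2" using dist_le[of m n] M[of m] that by simp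
      then show ?thesis using \<open>\<epsilon> > 0\<close> by (simp add: power_less_imp_less_base)
    qed
    then show "\<exists>M. \<forall>m\<ge>M. \<forall>n>m. dist (u m) (u n) < \<epsilon>" by blast
  qed
  then obtain z where z: "u \<longlonglongrightarrow> z"
    using Cauchy_convergent convergent_def by blast
  have "z \<in> C n" for n
  proof (rule closed_sequentially[OF closed])
    show "\<And>k. u (k + n) \<in> C n" using u sub[of n] by (meson le_add2 subsetD)
    show "(\<lambda>k. u (k + n)) \<longlonglongrightarrow> z" using z by (rule LIMSEQ_ignore_initial_segment)
  qed
  then show ?thesis by blast
qed

text \<open>
  No lower bound on \<open>J\<close> is needed: if the infimum is \<open>-\<infinity>\<close>, the argument produces a point where
  that value is attained.
\<close>
lemma attains_min_Hilbert:
  fixes J :: "'a::{real_inner,complete_space} \<Rightarrow> ereal"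
  assumes closed: "\<And>a::real. closed {v. J v \<le> a}" and convex: "\<And>a::real. convex {v. J v \<le> a}"
    and bounded: "\<And>a::real. bounded {v. J v \<le> a}"
  shows "\<exists>v. \<forall>z. J v \<le> J z"
proof (cases "(INF v. J v) = \<infinity>")
  case True
  then have "J v = \<infinity>" for v using INF_lower[of v UNIV J] by simp
  then show ?thesis by simp
next
  case False
  define m where "m = (INF v. J v)"
  from False have "m < \<infinity>" by (simp add: m_def)
  then obtain e where e: "m < e" "e < \<infinity>" using dense by blast
  obtain c where c: "\<And>n. m < c n" "c \<longlonglongrightarrow> m"
    using approx_from_above_dense_linorder[OF e(1)] by auto
  \<comment> \<open>Cutting off at \<open>e\<close> keeps the levels finite; the assumptions speak of real levels only.\<close>
  define b where "b n = min (c n) e" for n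
  have b: "m < b n" "b n < \<infinity>" for n
    using c(1)[of n] e le_less_trans[OF min.cobounded2 e(2), of "c n"] by (simp_all add: b_def)
  have "b \<longlonglongrightarrow> min m e" unfolding b_def by (intro tendsto_min c tendsto_const)
  then have b_lim: "b \<longlonglongrightarrow> m" using e by (simp add: min_absorb1)
  define a where "a n = real_of_ereal (b n)" for n
  have ba: "b n = ereal (a n)" for n
    using b(1)[of n] b(2)[of n] unfolding a_def by (cases "b n") auto
  define C where "C n = (\<Inter>k\<in>{..n}. {v. J v \<le> a k})" for n
  have "(\<Inter>n. C n) \<noteq> {}"
  proof (rule decseq_convex_closed_Inter_nonempty)
    show "closed (C n)" for n unfolding C_def using closed by blast
    show "convex (C n)" for n unfolding C_def using convex by (intro convex_INT)
    show "bounded (C 0)" unfolding C_def using bounded by simp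
    show "decseq C" unfolding C_def decseq_def by (auto intro: order_trans)
    show "C n \<noteq> {}" for n
    proof -
      have "m < Min (b ` {..n})" using b(1) by simp
      then obtain v where "J v < Min (b ` {..n})" unfolding m_def by (auto simp: INF_less_iff)
      then have "v \<in> C n" by (auto simp: C_def ba intro: less_imp_le)
      then show ?thesis by blast
    qed
  qed
  then obtain v where v: "v \<in> C n" for n by blast
  have "J v \<le> b n" for n using v[of n] by (auto simp: C_def ba)
  then have "J v \<le> m" by (intro LIMSEQ_le_const[OF b_lim]) auto
  moreover have "m \<le> J z" for z unfolding m_def by (rule INF_lower) simp
  ultimately show ?thesis by (meson order_trans)
qed

lemma convex_fun_imp_convex_sublevel:
  assumes "convex_fun J"
  shows "convex {v. J v \<le> ereal a}"
  unfolding convex_alt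
proof (intro ballI allI impI CollectI)
  fix v z t
  assume v: "v \<in> {v. J v \<le> ereal a}" "z \<in> {v. J v \<le> ereal a}" and t: "0 \<le> t \<and> t \<le> (1::real)"
  have "J ((1 - t) *\<^sub>R v + t *\<^sub>R z) \<le> ereal (1 - t) * J v + ereal t * J z"
    using assms t unfolding convex_fun_def by auto
  also have "\<dots> \<le> ereal (1 - t) * ereal a + ereal t * ereal a"
    using v t by (intro add_mono ereal_mult_left_mono) auto
  also have "\<dots> = ereal a" by (simp add: algebra_simps)
  finally show "J ((1 - t) *\<^sub>R v + t *\<^sub>R z) \<le> ereal a" .
qed

lemma power2_norm_convex_combination_le:
  fixes u v :: "'a::real_inner"
  assumes "0 \<le> t" "t \<le> 1"
  shows "(norm ((1 - t) *\<^sub>R u + t *\<^sub>R v))\<^sup>2 \<le> (1 - t) * (norm u)\<^sup>2 + t * (norm v)\<^sup>2"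
proof -
  have "(1 - t) * (norm u)\<^sup>2 + t * (norm v)\<^sup>2 - (norm ((1 - t) *\<^sub>R u + t *\<^sub>R v))\<^sup>2
        = t * (1 - t) * (norm (u - v))\<^sup>2"
    unfolding power2_norm_eq_inner by (simp add: inner_simps inner_commute) algebra
  also have "\<dots> \<ge> 0" using assms by simp
  finally show ?thesis by simp
qed

section \<open>Riesz representation and the adjoint\<close>

text \<open>
  Riesz representation: the representing vector is the minimizer of
  \<open>\<lambda>v. 1/2 * (norm v)\<^sup>2 - f v\<close>, whose Euler equation reads \<open>f h = h \<bullet> p\<close>.
\<close>
lemma bounded_linear_eq_inner:
  fixes f :: "'a::{real_inner,complete_space} \<Rightarrow> real"
  assumes "bounded_linear f"
  shows "\<exists>p. \<forall>v. f v = v \<bullet> p"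
proof -
  interpret bounded_linear f by fact
  obtain K where K: "\<And>v. norm (f v) \<le> norm v * K" "K > 0"
    using pos_bounded by blast
  define J where "J v = 1/2 * (norm v)\<^sup>2 - f v" for v
  have "\<exists>v. \<forall>z. ereal (J v) \<le> ereal (J z)"
  proof (rule attains_min_Hilbert)
    fix a :: real
    have "continuous_on UNIV J"
      unfolding J_def by (intro continuous_intros linear_continuous_on assms)
    then show "closed {v. ereal (J v) \<le> ereal a}"
      by (simp add: closed_Collect_le continuous_on_const)
    have "convex_fun (\<lambda>v. ereal (J v))"
      unfolding convex_fun_def
    proof (intro allI ballI)
      fix u v :: 'a and t :: real assume "t \<in> {0..1}"
      then show "ereal (J ((1 - t) *\<^sub>R u + t *\<^sub>R v)) \<le> ereal (1 - t) * ereal (J u) + ereal t * ereal (J v)"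
        using power2_norm_convex_combination_le[of t u v]
        unfolding J_def add scale by (simp add: field_simps)
    qed
    then show "convex {v. ereal (J v) \<le> ereal a}" by (rule convex_fun_imp_convex_sublevel)
    have "norm v \<le> 2 * (K + \<bar>a\<bar> + 1)" if "J v \<le> a" for v
    proof (rule ccontr)
      assume *: "\<not> ?thesis"
      then have "1 * (\<bar>a\<bar> + 1) \<le> norm v * (1/2 * norm v - K)"
        using K(2) by (intro mult_mono) auto
      also have "\<dots> = 1/2 * (norm v)\<^sup>2 - norm v * K" by (simp add: power2_eq_square algebra_simps)
      also have "\<dots> \<le> J v" using K(1)[of v] unfolding J_def by simp
      finally show False using that abs_ge_self[of a] by simp
    qed
    then show "bounded {v. ereal (J v) \<le> ereal a}"
      unfolding bounded_iff by auto
  qed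
  then obtain p where p: "\<And>z. J p \<le> J z" by auto
  have "f h = h \<bullet> p" for h
  proof (cases "h = 0")
    case False
    define g where "g = h \<bullet> p - f h"
    \<comment> \<open>The minimizing step length for \<open>J\<close> along \<open>p - t *\<^sub>R h\<close>.\<close>
    define t where "t = g / (h \<bullet> h)"
    have hh: "h \<bullet> h > 0" using False by simp
    have "J (p - t *\<^sub>R h) = J p - t * g + 1/2 * t\<^sup>2 * (h \<bullet> h)"
      unfolding J_def g_def power2_norm_eq_inner diff scale
      by (simp add: inner_simps inner_commute power2_eq_square algebra_simps)
    also have "\<dots> = J p - 1/2 * g\<^sup>2 / (h \<bullet> h)"
      using hh by (simp add: t_def field_simps power2_eq_square)
    finally have "g\<^sup>2 / (h \<bullet> h) \<le> 0" using p[of "p - t *\<^sub>R h"] by simp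
    then have "g\<^sup>2 \<le> 0" using hh by (simp add: divide_le_0_iff)
    then show ?thesis by (simp add: g_def)
  qed (simp add: zero)
  then show ?thesis by blast
qed

text \<open>
  The constant \<open>adjoint\<close> is defined by choice; Riesz representation supplies the function that makes
  the choice meaningful for bounded operators on a Hilbert space.
\<close>
lemma inner_adjoint_blinfun:
  fixes A :: "'a::{real_inner,complete_space} \<Rightarrow>\<^sub>L 'b::real_inner"
  shows "v \<bullet> adjoint (blinfun_apply A) w = A v \<bullet> w"
proof -
  have "\<exists>p. \<forall>v. A v \<bullet> w = v \<bullet> p" for w
    by (rule bounded_linear_eq_inner)
      (intro bounded_linear_compose[OF bounded_linear_inner_left] blinfun.bounded_linear_right)
  then have "\<exists>A'. \<forall>v w. A v \<bullet> w = v \<bullet> A' w" by metis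
  then have "\<forall>v w. A v \<bullet> w = v \<bullet> adjoint (blinfun_apply A) w"
    unfolding adjoint_def by (rule someI_ex)
  then show ?thesis by simp
qed

section \<open>Existence of Tikhonov minimizers\<close>

lemma convex_fun_tikhonov:
  fixes B :: "'a::real_normed_vector \<Rightarrow>\<^sub>L 'b::real_inner"
  assumes "convex_fun R" "0 < \<alpha>" and R: "\<And>z. 0 \<le> R z"
  shows "convex_fun (tikhonov R \<alpha> y B)"
  unfolding convex_fun_def
proof (intro allI ballI)
  fix u v :: 'a and t :: real assume t: "t \<in> {0..1}"
  let ?q = "\<lambda>v. 1/2 * (norm (B v - y))\<^sup>2"
  have "B ((1 - t) *\<^sub>R u + t *\<^sub>R v) - y = (1 - t) *\<^sub>R (B u - y) + t *\<^sub>R (B v - y)"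
    by (simp add: blinfun.add_right blinfun.diff_right blinfun.scaleR_right scaleR_right_diff_distrib scaleR_left_diff_distrib)
  with t have "?q ((1 - t) *\<^sub>R u + t *\<^sub>R v) \<le> (1 - t) * ?q u + t * ?q v"
    using power2_norm_convex_combination_le[of t "B u - y" "B v - y"] by simp
  moreover have "ereal \<alpha> * R ((1 - t) *\<^sub>R u + t *\<^sub>R v)
      \<le> ereal \<alpha> * (ereal (1 - t) * R u + ereal t * R v)"
    using assms t unfolding convex_fun_def by (intro ereal_mult_left_mono) auto
  ultimately have "tikhonov R \<alpha> y B ((1 - t) *\<^sub>R u + t *\<^sub>R v)
      \<le> ereal ((1 - t) * ?q u + t * ?q v) + ereal \<alpha> * (ereal (1 - t) * R u + ereal t * R v)"
    unfolding tikhonov_def by (intro add_mono) auto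
  \<comment> \<open>For infinite values of \<open>R\<close> the cases \<open>t = 0\<close> and \<open>t = 1\<close> are separate, since \<open>0 * \<infinity> = 0\<close>.\<close>
  also have "\<dots> = ereal (1 - t) * tikhonov R \<alpha> y B u + ereal t * tikhonov R \<alpha> y B v"
    using R[of u] R[of v] t \<open>0 < \<alpha>\<close> unfolding tikhonov_def
    by (cases "R u"; cases "R v"; cases "t = 0"; cases "t = 1") (auto simp: algebra_simps)
  finally show "tikhonov R \<alpha> y B ((1 - t) *\<^sub>R u + t *\<^sub>R v)
      \<le> ereal (1 - t) * tikhonov R \<alpha> y B u + ereal t * tikhonov R \<alpha> y B v" .
qed

text \<open>
  Sublevel sets are closed in the norm topology, since norm convergence implies weak convergence.
\<close>
lemma closed_sublevel_tikhonov:
  fixes B :: "'a::real_normed_vector \<Rightarrow>\<^sub>L 'b::real_normed_vector"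
  assumes lsc: "weakly_lsc R" and \<alpha>: "0 < \<alpha>" and R: "\<And>z. 0 \<le> R z"
  shows "closed {v. tikhonov R \<alpha> y B v \<le> ereal a}"
  unfolding closed_sequential_limits
proof (intro allI impI, elim conjE)
  fix X l assume X: "\<forall>n. X n \<in> {v. tikhonov R \<alpha> y B v \<le> ereal a}" and l: "X \<longlonglongrightarrow> l"
  let ?q = "\<lambda>v. 1/2 * (norm (B v - y))\<^sup>2"
  \<comment> \<open>The sublevel condition is solved for \<open>R\<close>, which avoids limits of sums in \<open>ereal\<close>.\<close>
  have "R (X n) \<le> ereal ((a - ?q (X n)) / \<alpha>)" for n
    using X[rule_format, of n] R[of "X n"] \<alpha> unfolding tikhonov_def
    by (cases "R (X n)") (auto simp: field_simps)
  then have "liminf (\<lambda>n. R (X n)) \<le> liminf (\<lambda>n. ereal ((a - ?q (X n)) / \<alpha>))"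
    by (intro Liminf_mono) auto
  also have "(\<lambda>n. (a - ?q (X n)) / \<alpha>) \<longlonglongrightarrow> (a - ?q l) / \<alpha>"
    using \<alpha> by (intro tendsto_intros l) auto
  then have "liminf (\<lambda>n. ereal ((a - ?q (X n)) / \<alpha>)) = ereal ((a - ?q l) / \<alpha>)"
    by (intro lim_imp_Liminf) auto
  finally have "liminf (\<lambda>n. R (X n)) \<le> ereal ((a - ?q l) / \<alpha>)" .
  moreover have "weakly_tendsto X l"
    unfolding weakly_tendsto_def using l by (auto intro: tendsto_intros)
  ultimately have "R l \<le> ereal ((a - ?q l) / \<alpha>)"
    using lsc unfolding weakly_lsc_def by (meson order_trans)
  then show "l \<in> {v. tikhonov R \<alpha> y B v \<le> ereal a}"
    using R[of l] \<alpha> unfolding tikhonov_def by (cases "R l") (auto simp: field_simps)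
qed

lemma bounded_sublevel_tikhonov:
  assumes "coercive R" "0 < \<alpha>" and R: "\<And>z. 0 \<le> R z"
  shows "bounded {v. tikhonov R \<alpha> y B v \<le> ereal a}"
proof -
  have "eventually (\<lambda>v. ereal (a / \<alpha>) < R v) at_infinity"
    using assms(1) unfolding coercive_def by (rule order_tendstoD) simp
  then obtain b where b: "\<And>v. b \<le> norm v \<Longrightarrow> ereal (a / \<alpha>) < R v"
    by (auto simp: eventually_at_infinity)
  have "norm v \<le> b" if "tikhonov R \<alpha> y B v \<le> ereal a" for v
  proof (rule ccontr)
    assume "\<not> norm v \<le> b"
    with b[of v] have "ereal (a / \<alpha>) < R v" by simp
    then have "a < 1/2 * (norm (B v - y))\<^sup>2 + \<alpha> * real_of_ereal (R v) \<or> R v = \<infinity>"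
      using \<open>0 < \<alpha>\<close> R[of v]
      by (cases "R v")
        (auto simp: pos_divide_less_eq mult.commute[of \<alpha>] intro!: add_strict_increasing2)
    with that show False using R[of v] \<open>0 < \<alpha>\<close> unfolding tikhonov_def by (cases "R v") auto
  qed
  then show ?thesis unfolding bounded_iff by blast
qed

lemma tikhonov_minimizer_exists:
  fixes B :: "'a::{real_inner,complete_space} \<Rightarrow>\<^sub>L 'b::real_inner"
  assumes "\<And>z. 0 \<le> R z" "convex_fun R" "coercive R" "weakly_lsc R" "0 < \<alpha>"
  shows "\<exists>v. tikhonov_minimizer R \<alpha> y B v"
proof -
  have "\<exists>v. \<forall>z. tikhonov R \<alpha> y B v \<le> tikhonov R \<alpha> y B z"
    using assms by (intro attains_min_Hilbert closed_sublevel_tikhonov bounded_sublevel_tikhonov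
        convex_fun_imp_convex_sublevel convex_fun_tikhonov)
  then show ?thesis
    by (auto simp: tikhonov_minimizer_def is_arg_min_linorder)
qed

section \<open>Residual estimate and convergence rate\<close>

text \<open>
  Where \<open>R\<close> is finite somewhere, it is finite at every Tikhonov minimizer, and minimality can be
  stated as an inequality of real numbers.
\<close>
lemma tikhonov_minimizer_real:
  assumes min: "tikhonov_minimizer R \<alpha> y B v" and "0 < \<alpha>" and R: "\<And>z. 0 \<le> R z"
    and fin: "R x = ereal r"
  obtains s where "R v = ereal s" "s \<ge> 0"
    and "1/2 * (norm (B v - y))\<^sup>2 + \<alpha> * s \<le> 1/2 * (norm (B x - y))\<^sup>2 + \<alpha> * r"
proof -
  have "tikhonov R \<alpha> y B v \<le> tikhonov R \<alpha> y B x"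
    using min by (simp add: tikhonov_minimizer_def is_arg_min_linorder)
  then show thesis
    using that R[of v] \<open>0 < \<alpha>\<close> unfolding tikhonov_def fin by (cases "R v") auto
qed

text \<open>
  The classical residual estimate under the source condition. The subgradient inequality turns
  minimality of \<open>v\<close> into a quadratic inequality for the residual, which is solved by completing the
  square.
\<close>
lemma tikhonov_residual_le:
  fixes A :: "'a::{real_inner,complete_space} \<Rightarrow>\<^sub>L 'b::real_inner"
  assumes min: "tikhonov_minimizer R \<alpha> y' A v" and \<alpha>: "0 < \<alpha>" and R: "\<And>z. 0 \<le> R z"
    and source: "adjoint (blinfun_apply A) w \<in> subdifferential R x"
    and noise: "norm (y' - A x) \<le> \<delta>"
  shows "norm (A v - y') \<le> \<delta> + 2 * \<alpha> * norm w"
proof -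
  have fin: "R x < \<infinity>"
    and sub: "R x + ereal (adjoint (blinfun_apply A) w \<bullet> (v - x)) \<le> R v"
    using source by (auto simp: subdifferential_def split: if_splits)
  obtain r where r: "R x = ereal r" using fin R[of x] by (cases "R x") auto
  obtain s where s: "R v = ereal s"
    and le: "1/2 * (norm (A v - y'))\<^sup>2 + \<alpha> * s \<le> 1/2 * (norm (A x - y'))\<^sup>2 + \<alpha> * r"
    using tikhonov_minimizer_real[OF min \<alpha> R r] by metis
  let ?\<rho> = "norm (A v - y')"
  have "r + A (v - x) \<bullet> w \<le> s"
    using sub by (simp add: r s inner_commute[of "adjoint _ _"] inner_adjoint_blinfun)
  moreover have "- (A (v - x) \<bullet> w) \<le> (?\<rho> + \<delta>) * norm w"
  proof -
    have "A (v - x) = (A v - y') + (y' - A x)" by (simp add: blinfun.bilinear_simps)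
    then have "norm (A (v - x)) \<le> ?\<rho> + norm (y' - A x)"
      by (metis norm_triangle_ineq)
    with noise have "norm (A (v - x)) * norm w \<le> (?\<rho> + \<delta>) * norm w"
      by (intro mult_right_mono) auto
    then show ?thesis using Cauchy_Schwarz_ineq2[of "A (v - x)" w] by linarith
  qed
  ultimately have "r - s \<le> (?\<rho> + \<delta>) * norm w" by linarith
  then have "\<alpha> * (r - s) \<le> \<alpha> * ((?\<rho> + \<delta>) * norm w)" using \<alpha> by simp
  moreover have "(norm (A x - y'))\<^sup>2 \<le> \<delta>\<^sup>2"
    using noise by (intro power_mono) (auto simp: norm_minus_commute)
  ultimately have "?\<rho>\<^sup>2 \<le> \<delta>\<^sup>2 + 2 * (\<alpha> * ((?\<rho> + \<delta>) * norm w))"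
    using le by (simp add: algebra_simps)
  then have "(?\<rho> - \<alpha> * norm w)\<^sup>2 \<le> (\<delta> + \<alpha> * norm w)\<^sup>2"
    by (simp add: power2_eq_square algebra_simps)
  moreover have "0 \<le> \<delta> + \<alpha> * norm w" using noise \<alpha> by (smt (verit) norm_ge_zero mult_nonneg_nonneg)
  ultimately show ?thesis using power2_le_imp_le[of "?\<rho> - \<alpha> * norm w" "\<delta> + \<alpha> * norm w"] by simp
qed

theorem theorem3p12:
  fixes A :: "'a::{real_inner,complete_space} \<Rightarrow>\<^sub>L 'b::{real_inner,complete_space}"
    and R :: "'a \<Rightarrow> ereal"
    and y :: 'b and x :: 'a
    and y\<delta> :: "real \<Rightarrow> 'b" and xhat :: "real \<Rightarrow> 'a"
    and \<beta> c :: real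
  assumes "\<And>z. 0 \<le> R z"
    and "convex_fun R"
    and "coercive R"
    and "weakly_lsc R"
    and "\<exists>z. R z \<noteq> \<infinity>"
    and "R_minimizing_solution R A y x"
    and "\<exists>w. adjoint (blinfun_apply A) w \<in> subdifferential R x"
    and "\<And>\<delta>. \<delta> > 0 \<Longrightarrow> norm (y\<delta> \<delta> - y) \<le> \<delta>"
    and "\<beta> > 0"
    and "c > 0"
    and "\<And>\<delta>. \<delta> > 0 \<Longrightarrow> ADP_solution R A \<beta> (c * \<delta>) (y\<delta> \<delta>) (xhat \<delta>)"
  shows "\<exists>d :: real \<Rightarrow> real.
           (\<forall>\<delta>>0. ereal (d \<delta>) \<in> bregman R (xhat \<delta>) x) \<and>
           d \<in> O[at_right 0](\<lambda>\<delta>. \<delta>)"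
proof -
  have Ax: "A x = y"
    using assms(6) by (simp add: R_minimizing_solution_def is_arg_min_def)
  obtain w where source: "adjoint (blinfun_apply A) w \<in> subdifferential R x" using assms(7) by blast
  let ?p = "adjoint (blinfun_apply A) w"
  have fin: "R x < \<infinity>" and sub: "\<And>z. R x + ereal (?p \<bullet> (z - x)) \<le> R z"
    using source by (auto simp: subdifferential_def split: if_splits)
  obtain r where r: "R x = ereal r" using fin assms(1)[of x] by (cases "R x") auto
  define d where "d \<delta> = real_of_ereal (R (xhat \<delta>)) - r - ?p \<bullet> (xhat \<delta> - x)" for \<delta>
  define K where "K = 1 + 2 * c * norm w"
  \<comment> \<open>\<open>K * \<delta>\<close> bounds the residual under \<open>A\<close> of its Tikhonov minimizer, hence also that of
    \<open>xhat \<delta>\<close>; \<open>M * \<delta>\<close> bounds the residual of \<open>x\<close> under the operator \<open>B\<close> found below.\<close>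
  define M where "M = K / sqrt (2 * \<beta>) * norm x + 1"
  have K: "K > 0" unfolding K_def using \<open>c > 0\<close> by (simp add: add_pos_nonneg)
  have main: "ereal (d \<delta>) \<in> bregman R (xhat \<delta>) x \<and> norm (d \<delta>) \<le> (M\<^sup>2 / (2 * c) + (K + 1) * norm w) * norm \<delta>"
    if pos: "\<delta> > 0" for \<delta>
  proof -
    have \<alpha>: "c * \<delta> > 0" using \<open>c > 0\<close> pos by simp
    note noise = assms(8)[OF pos]
    let ?y = "y\<delta> \<delta>" and ?v = "xhat \<delta>"
    obtain B where min: "tikhonov_minimizer R (c * \<delta>) ?y B ?v"
      and outer: "\<And>B' z. tikhonov_minimizer R (c * \<delta>) ?y B' z \<Longrightarrow>
        1/2 * (norm (A ?v - ?y))\<^sup>2 + \<beta> * (norm (B - A))\<^sup>2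
          \<le> 1/2 * (norm (A z - ?y))\<^sup>2 + \<beta> * (norm (B' - A))\<^sup>2"
      using assms(11)[OF pos] unfolding ADP_solution_def is_arg_min_linorder by auto
    obtain z where z: "tikhonov_minimizer R (c * \<delta>) ?y A z"
      using tikhonov_minimizer_exists[OF assms(1-4) \<alpha>] by blast
    have "norm (A z - ?y) \<le> K * \<delta>"
      using tikhonov_residual_le[OF z \<alpha> assms(1) source, of \<delta>] noise
      by (simp add: Ax K_def algebra_simps)
    then have "(norm (A z - ?y))\<^sup>2 \<le> (K * \<delta>)\<^sup>2" by (intro power_mono) auto
    with outer[OF z] have bound: "(norm (A ?v - ?y))\<^sup>2 + 2 * \<beta> * (norm (B - A))\<^sup>2 \<le> (K * \<delta>)\<^sup>2"
      by simp
    have "(norm (A ?v - ?y))\<^sup>2 \<le> (K * \<delta>)\<^sup>2"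
      using bound \<open>\<beta> > 0\<close> by (smt (verit) mult_nonneg_nonneg zero_le_power2)
    then have res: "norm (A ?v - ?y) \<le> K * \<delta>"
      by (rule power2_le_imp_le) (use K pos in simp)
    have "(sqrt (2 * \<beta>) * norm (B - A))\<^sup>2 = 2 * \<beta> * (norm (B - A))\<^sup>2"
      using \<open>\<beta> > 0\<close> by (simp add: power_mult_distrib)
    also have "\<dots> \<le> (K * \<delta>)\<^sup>2"
      using bound zero_le_power2[of "norm (A ?v - ?y)"] by linarith
    finally have "(sqrt (2 * \<beta>) * norm (B - A))\<^sup>2 \<le> (K * \<delta>)\<^sup>2" .
    then have "sqrt (2 * \<beta>) * norm (B - A) \<le> K * \<delta>"
      by (rule power2_le_imp_le) (use K pos in simp)
    then have BA: "norm (B - A) \<le> K / sqrt (2 * \<beta>) * \<delta>"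
      using \<open>\<beta> > 0\<close> by (simp add: field_simps)
    have "norm (B x - ?y) \<le> M * \<delta>"
    proof -
      have "B x - ?y = (B - A) x + (y - ?y)" by (simp add: blinfun.bilinear_simps Ax)
      then have "norm (B x - ?y) \<le> norm ((B - A) x) + norm (y - ?y)"
        by (metis norm_triangle_ineq)
      also have "\<dots> \<le> norm (B - A) * norm x + \<delta>"
        using noise norm_blinfun[of "B - A" x] by (simp add: norm_minus_commute[of y] add_mono)
      also have "\<dots> \<le> K / sqrt (2 * \<beta>) * \<delta> * norm x + \<delta>"
        using BA by (intro add_mono mult_right_mono) auto
      finally show ?thesis by (simp add: M_def algebra_simps)
    qed
    then have M2: "(norm (B x - ?y))\<^sup>2 \<le> (M * \<delta>)\<^sup>2" by (intro power_mono) auto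
    obtain s where s: "R ?v = ereal s" "s \<ge> 0"
      and le: "1/2 * (norm (B ?v - ?y))\<^sup>2 + c * \<delta> * s \<le> 1/2 * (norm (B x - ?y))\<^sup>2 + c * \<delta> * r"
      using tikhonov_minimizer_real[OF min \<alpha> assms(1) r] by metis
    have d: "d \<delta> = s - r - ?p \<bullet> (?v - x)" by (simp add: d_def s)
    have "2 * (c * \<delta>) * (s - r) = 2 * (c * \<delta> * s - c * \<delta> * r)" by (simp add: algebra_simps)
    also have "\<dots> \<le> (norm (B x - ?y))\<^sup>2"
      using le zero_le_power2[of "norm (B ?v - ?y)"] by argo
    also note M2
    finally have "s - r \<le> (M * \<delta>)\<^sup>2 / (2 * (c * \<delta>))"
      using \<alpha> by (subst pos_le_divide_eq) (simp_all only: mult.commute[of "s - r"] mult_pos_pos zero_less_numeral)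
    also have "\<dots> = M\<^sup>2 / (2 * c) * \<delta>"
      using \<open>c > 0\<close> pos by (simp add: power2_eq_square field_simps)
    finally have sr: "s - r \<le> M\<^sup>2 / (2 * c) * \<delta>" .
    have "- (?p \<bullet> (?v - x)) = - (A (?v - x) \<bullet> w)"
      by (simp add: inner_commute[of ?p] inner_adjoint_blinfun)
    also have "\<dots> \<le> norm (A (?v - x)) * norm w"
      using Cauchy_Schwarz_ineq2[of "A (?v - x)" w] by linarith
    also have "\<dots> \<le> (K * \<delta> + \<delta>) * norm w"
    proof (rule mult_right_mono)
      have "A (?v - x) = (A ?v - ?y) + (?y - y)" by (simp add: blinfun.bilinear_simps Ax)
      then have "norm (A (?v - x)) \<le> norm (A ?v - ?y) + norm (?y - y)"
        by (metis norm_triangle_ineq)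
      then show "norm (A (?v - x)) \<le> K * \<delta> + \<delta>" using res noise by linarith
    qed simp
    finally have upper: "d \<delta> \<le> (M\<^sup>2 / (2 * c) + (K + 1) * norm w) * \<delta>"
      using sr unfolding d by (simp add: algebra_simps)
    have "0 \<le> d \<delta>" using sub[of ?v] by (simp add: d r s)
    moreover have "ereal (d \<delta>) \<in> bregman R ?v x"
      unfolding bregman_def using source by (auto simp: d r s intro!: exI[of _ ?p])
    ultimately show ?thesis using upper pos by simp
  qed
  have "d \<in> O[at_right 0](\<lambda>\<delta>. \<delta>)"
    by (rule bigoI[where c = "M\<^sup>2 / (2 * c) + (K + 1) * norm w"])
      (use main in \<open>auto simp: eventually_at_right_field intro!: exI[of _ 1]\<close>)
  with main show ?thesis by blast
qed

end
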